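(* Let $\mathcal{H}$ be a complex Hilbert space, let $G=\mathbb{Z}_2\oplus\mathbb{Z}_2=\{e,a,b,ab\}$ with $ab=ba$ and $a^2=b^2=(ab)^2=e$, and let $T:G\to\mathcal{B}(\mathcal{H})$ be such that $T(e)=I_{\mathcal{H}}$ and $T(s)=T(s)^*$ for all $s\in G$. Let $T(a)=T_1$, $T(b)=T_2$ and $T(ab)=T_3$. Then the following are equivalent. (1) $T$ is a positive definite function. (2) The block matrix $$\Delta_T=\begin{bmatrix} I_{\mathcal{H}}&T_1&T_2&T_3\\ T_1&I_{\mathcal{H}}&T_3&T_2\\ T_2&T_3&I_{\mathcal{H}}&T_1\\ T_3&T_2&T_1&I_{\mathcal{H}}\end{bmatrix}\ge 0 .$$ (3) $T_1$ is a contraction, $\pm T_2\le I_{\mathcal{H}}$, and there are contractions $\Gamma_+:\overline{(I_{\mathcal{H}}+T_2)\mathcal{H}}\to\overline{(I_{\mathcal{H}}+T_2)\mathcal{H}}$ and $\Gamma_-:\overline{(I_{\mathcal{H}}-T_2)\mathcal{H}}\to\overline{(I_{\mathcal{H}}-T_2)\mathcal{H}}$ such that $$T_1+T_3=(I_{\mathcal{H}}+T_2)^{1/2}\,\Gamma_+\,(I_{\mathcal{H}}+T_2)^{1/2}\quad\text{and}\quad T_1-T_3=(I_{\mathcal{H}}-T_2)^{1/2}\,\Gamma_-\,(I_{\mathcal{H}}-T_2)^{1/2}.$$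
   Context: $\mathcal{B}(\mathcal{H})$ is the algebra of bounded linear operators on $\mathcal{H}$; $A\ge 0$ means $\langle Ax,x\rangle\ge 0$ for all $x$; a contraction is an operator of norm at most one. For a group $G$, a map $T:G\to\mathcal{B}(\mathcal{H})$ is positive definite if $T(s^{-1})=T(s)^*$ for every $s\in G$ and $\sum_{s\in G}\sum_{t\in G}\langle T(t^{-1}s)h(s),h(t)\rangle\ge 0$ for every finitely supported function $h:G\to\mathcal{H}$. *)

theory Defs
  imports "HOL-Analysis.Analysis" "HOL-Algebra.Elementary_Groups"
begin

section \<open>Complex Hilbert spaces\<close>

text \<open>
  The inner product is linear in the first argument. The underlying real Banach space structure
  is tied to the complex structure by the last two axioms.
\<close>

class complex_hilbert = banach +
  fixes scaleC :: "complex \<Rightarrow> 'a \<Rightarrow> 'a"  (infixr \<open>*\<^sub>C\<close> 75)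
    and cinner :: "'a \<Rightarrow> 'a \<Rightarrow> complex"
  assumes scaleC_add_right: "c *\<^sub>C (x + y) = c *\<^sub>C x + c *\<^sub>C y"
    and scaleC_add_left: "(c + d) *\<^sub>C x = c *\<^sub>C x + d *\<^sub>C x"
    and scaleC_scaleC: "c *\<^sub>C (d *\<^sub>C x) = (c * d) *\<^sub>C x"
    and scaleC_one: "1 *\<^sub>C x = x"
    and cinner_commute: "cinner x y = cnj (cinner y x)"
    and cinner_add_left: "cinner (x + y) z = cinner x z + cinner y z"
    and cinner_scaleC_left: "cinner (c *\<^sub>C x) y = c * cinner x y"
    and cinner_nonneg: "cinner x x \<in> \<real>\<^sub>\<ge>\<^sub>0"
    and cinner_eq_zero_iff: "cinner x x = 0 \<longleftrightarrow> x = 0"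
    and scaleR_scaleC: "r *\<^sub>R x = complex_of_real r *\<^sub>C x"
    and norm_eq_sqrt_cinner: "norm x = sqrt (Re (cinner x x))"

instantiation complex :: complex_hilbert
begin

definition scaleC_complex :: "complex \<Rightarrow> complex \<Rightarrow> complex"
  where "scaleC_complex c x = c * x"

definition cinner_complex :: "complex \<Rightarrow> complex \<Rightarrow> complex"
  where "cinner_complex x y = x * cnj y"

instance
proof
  fix x y z c d :: complex and r :: real
  have self: "cinner x x = complex_of_real ((cmod x)\<^sup>2)"
    by (simp only: cinner_complex_def complex_norm_square)
  show "c *\<^sub>C (x + y) = c *\<^sub>C x + c *\<^sub>C y"
    by (simp add: scaleC_complex_def distrib_left)
  show "(c + d) *\<^sub>C x = c *\<^sub>C x + d *\<^sub>C x"
    by (simp add: scaleC_complex_def distrib_right)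
  show "c *\<^sub>C (d *\<^sub>C x) = (c * d) *\<^sub>C x"
    by (simp add: scaleC_complex_def mult.assoc)
  show "1 *\<^sub>C x = x"
    by (simp add: scaleC_complex_def)
  show "cinner x y = cnj (cinner y x)"
    by (simp add: cinner_complex_def mult.commute)
  show "cinner (x + y) z = cinner x z + cinner y z"
    by (simp add: cinner_complex_def distrib_right)
  show "cinner (c *\<^sub>C x) y = c * cinner x y"
    by (simp add: cinner_complex_def scaleC_complex_def mult.assoc)
  show "cinner x x \<in> \<real>\<^sub>\<ge>\<^sub>0"
    by (simp only: self nonneg_Reals_of_real_iff zero_le_power2)
  show "cinner x x = 0 \<longleftrightarrow> x = 0"
    by (simp add: cinner_complex_def)
  show "r *\<^sub>R x = complex_of_real r *\<^sub>C x"
    by (simp only: scaleC_complex_def scaleR_conv_of_real)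
  show "norm x = sqrt (Re (cinner x x))"
    by (simp only: self Re_complex_of_real real_sqrt_abs abs_norm_cancel)
qed

end

text \<open>
  The Hilbert space direct sum of finitely many copies of a Hilbert space; its norm is the
  Euclidean one that the library puts on \<open>'a ^ 'n\<close>.
\<close>

instantiation vec :: (complex_hilbert, finite) complex_hilbert
begin

definition scaleC_vec :: "complex \<Rightarrow> 'a ^ 'b \<Rightarrow> 'a ^ 'b"
  where "scaleC_vec c x = (\<chi> i. c *\<^sub>C (x $ i))"

definition cinner_vec :: "'a ^ 'b \<Rightarrow> 'a ^ 'b \<Rightarrow> complex"
  where "cinner_vec x y = (\<Sum>i\<in>UNIV. cinner (x $ i) (y $ i))"

instance
proof
  fix x y z :: "'a ^ 'b" and c d :: complex and r :: real
  have self: "cinner u u = complex_of_real ((norm u)\<^sup>2)" for u :: 'a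
  proof -
    have "cinner u u \<in> \<real>\<^sub>\<ge>\<^sub>0" by (rule cinner_nonneg)
    then obtain t where t: "cinner u u = complex_of_real t" "t \<ge> 0"
      by (auto elim: nonneg_Reals_cases)
    then show ?thesis by (simp add: norm_eq_sqrt_cinner)
  qed
  have selfv: "cinner x x = complex_of_real ((norm x)\<^sup>2)"
    by (simp add: cinner_vec_def self norm_vec_def L2_set_def sum_nonneg)
  show "c *\<^sub>C (x + y) = c *\<^sub>C x + c *\<^sub>C y"
    by (simp add: scaleC_vec_def vec_eq_iff scaleC_add_right)
  show "(c + d) *\<^sub>C x = c *\<^sub>C x + d *\<^sub>C x"
    by (simp add: scaleC_vec_def vec_eq_iff scaleC_add_left)
  show "c *\<^sub>C (d *\<^sub>C x) = (c * d) *\<^sub>C x"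
    by (simp add: scaleC_vec_def vec_eq_iff scaleC_scaleC)
  show "1 *\<^sub>C x = x"
    by (simp add: scaleC_vec_def vec_eq_iff scaleC_one)
  show "cinner x y = cnj (cinner y x)"
    unfolding cinner_vec_def cnj_sum by (intro sum.cong refl cinner_commute)
  show "cinner (x + y) z = cinner x z + cinner y z"
    by (simp add: cinner_vec_def cinner_add_left sum.distrib)
  show "cinner (c *\<^sub>C x) y = c * cinner x y"
    by (simp add: cinner_vec_def scaleC_vec_def cinner_scaleC_left sum_distrib_left)
  show "cinner x x \<in> \<real>\<^sub>\<ge>\<^sub>0"
    by (simp only: selfv nonneg_Reals_of_real_iff) simp
  show "cinner x x = 0 \<longleftrightarrow> x = 0"
    by (simp add: selfv)
  show "r *\<^sub>R x = complex_of_real r *\<^sub>C x"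
    by (simp add: scaleC_vec_def vec_eq_iff scaleR_scaleC)
  show "norm x = sqrt (Re (cinner x x))"
    by (simp add: selfv)
qed

end


section \<open>Bounded operators\<close>

text \<open>
  The library type \<open>'a \<Rightarrow>\<^sub>L 'a\<close> consists of the bounded real-linear maps, so the algebra of bounded
  operators on a complex Hilbert space is a proper subset of it. The operator norm is the same.
\<close>

definition bounded_ops :: "('a::complex_hilbert \<Rightarrow>\<^sub>L 'a) set"
  where "bounded_ops = {A. \<forall>c x. blinfun_apply A (c *\<^sub>C x) = c *\<^sub>C blinfun_apply A x}"

text \<open>The choice is unique, by nondegeneracy of the inner product.\<close>

definition adj_op :: "('a::complex_hilbert \<Rightarrow>\<^sub>L 'a) \<Rightarrow> ('a \<Rightarrow>\<^sub>L 'a)"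
  where "adj_op A = (SOME B. B \<in> bounded_ops \<and> (\<forall>x y. cinner (A x) y = cinner x (B y)))"

definition positive_op :: "('a::complex_hilbert \<Rightarrow>\<^sub>L 'a) \<Rightarrow> bool"
  where "positive_op A \<longleftrightarrow> (\<forall>x. cinner (A x) x \<in> \<real>\<^sub>\<ge>\<^sub>0)"

definition le_op :: "('a::complex_hilbert \<Rightarrow>\<^sub>L 'a) \<Rightarrow> ('a \<Rightarrow>\<^sub>L 'a) \<Rightarrow> bool"
  where "le_op A B \<longleftrightarrow> positive_op (B - A)"

text \<open>
  The positive square root; a positive operator has exactly one, so the choice is immaterial.
\<close>

definition sqrt_op :: "('a::complex_hilbert \<Rightarrow>\<^sub>L 'a) \<Rightarrow> ('a \<Rightarrow>\<^sub>L 'a)"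
  where "sqrt_op A = (SOME S. S \<in> bounded_ops \<and> positive_op S \<and> S o\<^sub>L S = A)"

definition contraction :: "('a::complex_hilbert \<Rightarrow>\<^sub>L 'a) \<Rightarrow> bool"
  where "contraction A \<longleftrightarrow> A \<in> bounded_ops \<and> norm A \<le> 1"

text \<open>
  A contraction \<open>K \<rightarrow> K\<close> on a closed subspace \<open>K\<close>; the values of \<open>\<Gamma>\<close> outside \<open>K\<close> are irrelevant.
\<close>

definition contraction_on :: "'a::complex_hilbert set \<Rightarrow> ('a \<Rightarrow> 'a) \<Rightarrow> bool"
  where "contraction_on K \<Gamma> \<longleftrightarrow>
    \<Gamma> \<in> K \<rightarrow> K \<and>
    (\<forall>x\<in>K. \<forall>y\<in>K. \<Gamma> (x + y) = \<Gamma> x + \<Gamma> y) \<and>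
    (\<forall>c. \<forall>x\<in>K. \<Gamma> (c *\<^sub>C x) = c *\<^sub>C \<Gamma> x) \<and>
    (\<forall>x\<in>K. norm (\<Gamma> x) \<le> norm x)"

text \<open>
  The operator on the direct sum given by an operator matrix; \<open>M $ i $ j\<close> is the entry in row \<open>i\<close>
  and column \<open>j\<close>.
\<close>

definition block_op ::
  "('a::complex_hilbert \<Rightarrow>\<^sub>L 'a) ^ 'n::finite ^ 'n \<Rightarrow> (('a ^ 'n) \<Rightarrow>\<^sub>L ('a ^ 'n))"
  where "block_op M = Blinfun (\<lambda>x. \<chi> i. \<Sum>j\<in>UNIV. (M $ i $ j) (x $ j))"

lemma block_op_apply:
  fixes M :: "('a::complex_hilbert \<Rightarrow>\<^sub>L 'a) ^ 'n::finite ^ 'n"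
  shows "block_op M x = (\<chi> i. \<Sum>j\<in>UNIV. (M $ i $ j) (x $ j))"
proof -
  have "bounded_linear (\<lambda>x. \<chi> i. \<Sum>j\<in>UNIV. (M $ i $ j) (x $ j))"
  proof (rule bounded_linear_intro)
    fix x y :: "'a ^ 'n" and r :: real
    show "(\<chi> i. \<Sum>j\<in>UNIV. (M $ i $ j) ((x + y) $ j)) =
        (\<chi> i. \<Sum>j\<in>UNIV. (M $ i $ j) (x $ j)) + (\<chi> i. \<Sum>j\<in>UNIV. (M $ i $ j) (y $ j))"
      by (simp add: vec_eq_iff blinfun.add_right sum.distrib)
    show "(\<chi> i. \<Sum>j\<in>UNIV. (M $ i $ j) ((r *\<^sub>R x) $ j)) =
        r *\<^sub>R (\<chi> i. \<Sum>j\<in>UNIV. (M $ i $ j) (x $ j))"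
      by (simp add: vec_eq_iff blinfun.scaleR_right scaleR_sum_right)
    have "norm (\<chi> i. \<Sum>j\<in>UNIV. (M $ i $ j) (x $ j)) \<le>
        (\<Sum>i\<in>UNIV. norm (\<Sum>j\<in>UNIV. (M $ i $ j) (x $ j)))"
      unfolding norm_vec_def by (rule order_trans[OF L2_set_le_sum]) simp_all
    also have "\<dots> \<le> (\<Sum>i\<in>UNIV. \<Sum>j\<in>UNIV. norm x * norm (M $ i $ j))"
    proof (intro sum_mono order_trans[OF norm_sum])
      fix i j
      have "norm ((M $ i $ j) (x $ j)) \<le> norm (M $ i $ j) * norm (x $ j)"
        by (rule norm_blinfun)
      also have "\<dots> \<le> norm (M $ i $ j) * norm x"
        by (intro mult_left_mono Finite_Cartesian_Product.norm_nth_le norm_ge_zero)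
      finally show "norm ((M $ i $ j) (x $ j)) \<le> norm x * norm (M $ i $ j)"
        by (simp only: mult.commute)
    qed
    finally show "norm (\<chi> i. \<Sum>j\<in>UNIV. (M $ i $ j) (x $ j)) \<le>
        norm x * (\<Sum>i\<in>UNIV. \<Sum>j\<in>UNIV. norm (M $ i $ j))"
      by (simp only: sum_distrib_left)
  qed
  then show ?thesis
    by (simp add: block_op_def bounded_linear_Blinfun_apply)
qed


section \<open>Positive definite operator-valued functions on a group\<close>

definition positive_definite ::
  "('g, 'm) monoid_scheme \<Rightarrow> ('g \<Rightarrow> 'a::complex_hilbert \<Rightarrow>\<^sub>L 'a) \<Rightarrow> bool"
  where "positive_definite G T \<longleftrightarrow>
    (\<forall>s\<in>carrier G. T (inv\<^bsub>G\<^esub> s) = adj_op (T s)) \<and>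
    (\<forall>h. finite {s \<in> carrier G. h s \<noteq> 0} \<longrightarrow>
      (\<Sum>s\<in>{s \<in> carrier G. h s \<noteq> 0}. \<Sum>t\<in>{t \<in> carrier G. h t \<noteq> 0}.
        cinner (T (inv\<^bsub>G\<^esub> t \<otimes>\<^bsub>G\<^esub> s) (h s)) (h t)) \<in> \<real>\<^sub>\<ge>\<^sub>0)"

end

theory Submission
  imports Defs
begin

text \<open>
  Adding and subtracting the coordinates that \<open>b\<close> exchanges splits the quadratic form of the
  block matrix into those of the \<open>2 \<times> 2\<close> matrices with diagonal \<open>I \<plusminus> T2\<close> and off-diagonal
  \<open>T1 \<plusminus> T3\<close>. With \<open>S\<close> the square root of the diagonal and \<open>B\<close> the off-diagonal, such a form is
  nonnegative iff \<open>\<bar>\<langle>B u, v\<rangle>\<bar> \<le> \<parallel>S u\<parallel> \<parallel>S v\<parallel>\<close>, and two applications of the Riesz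
  representation theorem turn this bound into a factorization \<open>B = S \<Gamma> S\<close>.
\<close>

section \<open>The inner product\<close>

text \<open>Formally \<open>\<Gamma>\<close> is \<open>B\<close> divided by \<open>S\<close> on both
  sides, but \<open>S\<close> may have a kernel and a range that is not closed. The Riesz theorem is
  therefore stated for functionals bounded by \<open>C * norm (L v)\<close> with an arbitrary linear
  \<open>L\<close>: taking \<open>L = S\<close> performs one division and puts the quotient into the
  closure of \<open>range S\<close>. There \<open>S\<close> is injective, so quotients are unique
  and depend linearly on the data. The theorem speaks of the closed range of
  \<open>I \<plusminus> T2\<close> instead; it is the same space because
  \<open>I \<plusminus> T2\<close> is the square of \<open>S\<close>. Since \<open>adj_op\<close>
  and \<open>sqrt_op\<close> are choices, they say nothing until an operator with the required
  properties is constructed. For the root this construction asks for \<open>norm T2 \<le> 1\<close>,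
  which is what \<open>\<plusminus> T2 \<le> I\<close> provides.\<close>

lemma cinner_add_right:
  fixes x y z :: "'a::complex_hilbert"
  shows "cinner x (y + z) = cinner x y + cinner x z"
  by (metis cinner_add_left cinner_commute complex_cnj_add)

lemma cinner_scaleC_right:
  fixes x y :: "'a::complex_hilbert"
  shows "cinner x (c *\<^sub>C y) = cnj c * cinner x y"
  by (metis cinner_commute cinner_scaleC_left complex_cnj_mult)

lemma cinner_self:
  fixes x :: "'a::complex_hilbert"
  shows "cinner x x = complex_of_real ((norm x)\<^sup>2)"
proof -
  obtain t where "cinner x x = complex_of_real t" "t \<ge> 0"
    using cinner_nonneg[of x] by (auto elim: nonneg_Reals_cases)
  then show ?thesis by (simp add: norm_eq_sqrt_cinner)
qed

text \<open>The class comes with a norm, so the triangle inequality is available and yields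
  Cauchy-Schwarz, reversing the usual order.\<close>

lemma Re_cinner_le:
  fixes x y :: "'a::complex_hilbert"
  shows "Re (cinner x y) \<le> norm x * norm y"
proof -
  have "Re (cinner y x) = Re (cinner x y)"
    by (subst cinner_commute) simp
  then have "(norm (x + y))\<^sup>2 = (norm x)\<^sup>2 + (norm y)\<^sup>2 + 2 * Re (cinner x y)"
    using arg_cong[OF cinner_self[of "x + y"], of Re]
    by (simp add: cinner_add_left cinner_add_right cinner_self[of x] cinner_self[of y])
  moreover have "(norm (x + y))\<^sup>2 \<le> (norm x + norm y)\<^sup>2"
    by (intro power_mono norm_triangle_ineq) simp
  ultimately show ?thesis by (simp add: power2_sum)
qed

lemma norm_scaleC:
  fixes x :: "'a::complex_hilbert"
  shows "norm (c *\<^sub>C x) = cmod c * norm x"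
proof -
  have "complex_of_real ((norm (c *\<^sub>C x))\<^sup>2) = complex_of_real ((cmod c)\<^sup>2 * (norm x)\<^sup>2)"
    unfolding cinner_self[of "c *\<^sub>C x", symmetric] of_real_mult complex_norm_square
    by (simp add: cinner_scaleC_left cinner_scaleC_right cinner_self[of x])
  then have "(norm (c *\<^sub>C x))\<^sup>2 = (cmod c * norm x)\<^sup>2"
    by (simp only: of_real_eq_iff power_mult_distrib)
  then show ?thesis by (simp add: power2_eq_iff_nonneg)
qed

lemma norm_cinner_le:
  fixes x y :: "'a::complex_hilbert"
  shows "cmod (cinner x y) \<le> norm x * norm y"
proof (cases "cinner x y = 0")
  case False
  \<comment> \<open>A unimodular factor that rotates the inner product onto its modulus.\<close>
  define c where "c = cnj (cinner x y) / cmod (cinner x y)"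
  have "cinner (c *\<^sub>C x) y = cmod (cinner x y)"
    using False by (simp add: c_def cinner_scaleC_left field_simps complex_norm_square[symmetric] power2_eq_square)
  moreover have "cmod c = 1" using False by (simp add: c_def norm_divide)
  ultimately show ?thesis
    using Re_cinner_le[of "c *\<^sub>C x" y] by (simp add: norm_scaleC)
qed simp

lemma bounded_bilinear_cinner:
  "bounded_bilinear (cinner :: 'a::complex_hilbert \<Rightarrow> 'a \<Rightarrow> complex)"
proof
  fix x y z :: 'a and r :: real
  show "cinner (x + y) z = cinner x z + cinner y z" by (rule cinner_add_left)
  show "cinner x (y + z) = cinner x y + cinner x z" by (rule cinner_add_right)
  show "cinner (r *\<^sub>R x) y = r *\<^sub>R cinner x y"
    by (simp add: scaleR_scaleC[of r x] cinner_scaleC_left scaleR_conv_of_real)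
  show "cinner x (r *\<^sub>R y) = r *\<^sub>R cinner x y"
    by (simp add: scaleR_scaleC[of r y] cinner_scaleC_right scaleR_conv_of_real)
  show "\<exists>K. \<forall>(x::'a) y. norm (cinner x y) \<le> norm x * norm y * K"
    by (rule exI[of _ 1]) (simp add: norm_cinner_le)
qed

interpretation cinner: bounded_bilinear cinner
  by (rule bounded_bilinear_cinner)

lemma cinner_Re_commute:
  fixes x y :: "'a::complex_hilbert"
  shows "Re (cinner x y) = Re (cinner y x)"
  by (subst cinner_commute) simp

lemma norm_add_square:
  fixes x y :: "'a::complex_hilbert"
  shows "(norm (x + y))\<^sup>2 = (norm x)\<^sup>2 + (norm y)\<^sup>2 + 2 * Re (cinner x y)"
  using arg_cong[OF cinner_self[of "x + y"], of Re]
  by (simp add: cinner.add_left cinner.add_right cinner_self[of x] cinner_self[of y]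
      cinner_Re_commute[of y x])

lemma cinner_ext:
  fixes y z :: "'a::complex_hilbert"
  assumes "\<And>x. cinner x y = cinner x z"
  shows "y = z"
proof -
  have "cinner (y - z) (y - z) = 0"
    using assms by (simp add: cinner.diff_right)
  then show ?thesis by (simp add: cinner_eq_zero_iff)
qed

lemma cinner_closure_eq_zero:
  fixes w z :: "'a::complex_hilbert"
  assumes "z \<in> closure M" and "\<And>x. x \<in> M \<Longrightarrow> cinner x w = 0"
  shows "cinner z w = 0"
proof -
  obtain s where s: "\<And>n. s n \<in> M" "s \<longlonglongrightarrow> z"
    using assms(1) by (auto simp: closure_sequential)
  have "(\<lambda>n. cinner (s n) w) \<longlonglongrightarrow> cinner z w"
    by (intro cinner.tendsto s tendsto_const)
  then show ?thesis using s(1) assms(2) by (simp add: LIMSEQ_const_iff)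
qed

section \<open>Riesz representation\<close>

text \<open>The discriminant criterion. With \<open>p = 0\<close> it gives the first-order condition
  at a minimum, with general \<open>p\<close> a bound of Cauchy-Schwarz type.\<close>

lemma quadratic_nonneg_imp:
  fixes p d q :: real
  assumes "\<And>t. 0 \<le> p + 2 * t * d + t\<^sup>2 * q" and "0 \<le> q"
  shows "d\<^sup>2 \<le> p * q"
proof (cases "q = 0")
  case True
  have "d = 0"
  proof (rule ccontr)
    assume "d \<noteq> 0"
    \<comment> \<open>At this \<open>t\<close> the affine function \<open>p + 2 * t * d\<close>
      equals -1.\<close>
    then show False using assms(1)[of "- (p + 1) / (2 * d)"] True
      by (simp add: field_simps)
  qed
  then show ?thesis using True by simp
next
  case False
  with assms(2) have "q > 0" by simp
  then have "p + 2 * (- d / q) * d + (- d / q)\<^sup>2 * q = p - d\<^sup>2 / q"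
    by (simp add: power2_eq_square field_simps)
  with assms(1)[of "- d / q"] have "d\<^sup>2 / q \<le> p" by linarith
  with \<open>q > 0\<close> show ?thesis
    by (simp add: pos_divide_le_eq)
qed

text \<open>
  The vector \<open>w\<close> is the limit of \<open>L v\<close> along a minimizing sequence of \<open>\<parallel>L v\<parallel>\<^sup>2 / 2 - f v\<close>. For
  \<open>L = id\<close> this is the Riesz representation theorem; for a general \<open>L\<close> it needs neither a
  closed range nor an extension of the functional to the closure of the range.
\<close>

lemma Riesz_closure_range_real:
  fixes L :: "'b::real_vector \<Rightarrow> 'a::complex_hilbert" and f :: "'b \<Rightarrow> real"
  assumes L: "linear L" and f: "linear f"
    and bound: "\<And>v. \<bar>f v\<bar> \<le> C * norm (L v)" and C: "0 \<le> C"
  shows "\<exists>w\<in>closure (range L). norm w \<le> C \<and> (\<forall>v. f v = Re (cinner (L v) w))"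
proof -
  define J where "J v = (norm (L v))\<^sup>2 / 2 - f v" for v
  define m where "m = Inf (range J)"
  have J_expand: "J (u + t *\<^sub>R v) = J u + t * (Re (cinner (L u) (L v)) - f v) + t\<^sup>2 * (norm (L v))\<^sup>2 / 2"
    for u v t
    by (simp add: J_def linear_add[OF L] linear_add[OF f] linear_scale[OF L] linear_scale[OF f]
        norm_add_square cinner.scaleR_right power_mult_distrib add_divide_distrib right_diff_distrib)
  \<comment> \<open>With \<open>r = norm (L v)\<close> the bound on \<open>f\<close> leaves
    \<open>r\<^sup>2 / 2 - C * r\<close>, which is smallest at \<open>r = C\<close>.\<close>
  have "J v \<ge> - (C\<^sup>2 / 2)" for v
  proof -
    have "0 \<le> (norm (L v) - C)\<^sup>2" by simp
    then have "C * norm (L v) \<le> (norm (L v))\<^sup>2 / 2 + C\<^sup>2 / 2"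
      by (simp add: power2_diff mult.commute)
    with bound[of v] show ?thesis by (simp add: J_def)
  qed
  then have bdd: "bdd_below (range J)" by (intro bdd_belowI[of _ "- (C\<^sup>2 / 2)"]) auto
  have m: "m \<le> J v" for v unfolding m_def by (rule cInf_lower) (use bdd in auto)
  have "\<exists>v. J v < m + 1 / real (Suc n)" for n
    using cInf_less_iff[of "range J" "m + 1 / real (Suc n)"] bdd by (auto simp: m_def)
  then obtain v where v: "\<And>n. J (v n) < m + 1 / real (Suc n)" by metis
  define e where "e n = 1 / real (Suc n)" for n
  have e: "e \<longlonglongrightarrow> 0" unfolding e_def by (rule lim_1_over_n[THEN LIMSEQ_Suc])
  \<comment> \<open>The mean of \<open>J (v n)\<close> and \<open>J (v k)\<close> exceeds
    \<open>J\<close> at the midpoint by an eighth of the left-hand side, and the midpoint value is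
    at least \<open>m\<close>.\<close>
  have near: "(norm (L (v n) - L (v k)))\<^sup>2 \<le> 4 * (e n + e k)" for n k
  proof -
    define d where "d = v k - v n"
    have k: "v k = v n + 1 *\<^sub>R d" by (simp add: d_def)
    have "J (v k) = J (v n) + 1 * (Re (cinner (L (v n)) (L d)) - f d) + 1\<^sup>2 * (norm (L d))\<^sup>2 / 2"
      by (subst k) (rule J_expand)
    moreover have "m \<le> J (v n) + (Re (cinner (L (v n)) (L d)) - f d) / 2 + (norm (L d))\<^sup>2 / 8"
      using m[of "v n + (1/2) *\<^sub>R d"] unfolding J_expand by (simp add: power_divide)
    moreover have "J (v n) < m + e n" "J (v k) < m + e k" using v by (auto simp: e_def)
    ultimately have "(norm (L d))\<^sup>2 \<le> 4 * (e n + e k)" by (simp add: field_simps)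
    then show ?thesis by (simp add: d_def linear_diff[OF L] norm_minus_commute)
  qed
  have "Cauchy (\<lambda>n. L (v n))"
  proof (rule metric_CauchyI)
    fix r :: real assume "0 < r"
    then have "0 < r\<^sup>2 / 8" by simp
    from order_tendstoD(2)[OF e this] obtain N where N: "\<And>n. n \<ge> N \<Longrightarrow> e n < r\<^sup>2 / 8"
      by (auto simp: eventually_sequentially)
    show "\<exists>M. \<forall>n\<ge>M. \<forall>k\<ge>M. dist (L (v n)) (L (v k)) < r"
    proof (intro exI allI impI)
      fix n k assume "n \<ge> N" "k \<ge> N"
      then have "(norm (L (v n) - L (v k)))\<^sup>2 < r\<^sup>2" using near[of n k] N[of n] N[of k] by simp
      then show "dist (L (v n)) (L (v k)) < r"
        using \<open>0 < r\<close> by (simp add: dist_norm power2_less_imp_less)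
    qed
  qed
  from Cauchy_convergent[OF this] obtain w where w: "(\<lambda>n. L (v n)) \<longlonglongrightarrow> w"
    by (auto simp: convergent_def)
  then have w_closure: "w \<in> closure (range L)"
    unfolding closure_sequential by (intro exI[of _ "\<lambda>n. L (v n)"]) simp
  have rep: "f u = Re (cinner (L u) w)" for u
  proof -
    \<comment> \<open>The infimum need not be attained, so the variation is taken at
      \<open>v n\<close>, where it is nonnegative up to \<open>e n\<close>, and then
      \<open>n\<close> tends to infinity. A zero constant term forces the linear coefficient to
      vanish.\<close>
    have "0 \<le> 0 + 2 * t * ((Re (cinner w (L u)) - f u) / 2) + t\<^sup>2 * ((norm (L u))\<^sup>2 / 2)" for t
    proof (rule LIMSEQ_le_const)
      show "(\<lambda>n. e n + 2 * t * ((Re (cinner (L (v n)) (L u)) - f u) / 2) + t\<^sup>2 * ((norm (L u))\<^sup>2 / 2))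
        \<longlonglongrightarrow> 0 + 2 * t * ((Re (cinner w (L u)) - f u) / 2) + t\<^sup>2 * ((norm (L u))\<^sup>2 / 2)"
        by (intro tendsto_intros e cinner.tendsto w) simp
      have "0 \<le> e n + 2 * t * ((Re (cinner (L (v n)) (L u)) - f u) / 2) + t\<^sup>2 * ((norm (L u))\<^sup>2 / 2)" for n
        using v[of n] m[of "v n + t *\<^sub>R u"] unfolding J_expand by (simp add: e_def)
      then show "\<exists>N. \<forall>n\<ge>N. 0 \<le> e n + 2 * t * ((Re (cinner (L (v n)) (L u)) - f u) / 2) + t\<^sup>2 * ((norm (L u))\<^sup>2 / 2)"
        by blast
    qed
    from quadratic_nonneg_imp[OF this] show ?thesis
      by (simp add: cinner_Re_commute)
  qed
  have "(norm w)\<^sup>2 \<le> C * norm w"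
  proof (rule LIMSEQ_le)
    show "(\<lambda>n. Re (cinner (L (v n)) w)) \<longlonglongrightarrow> (norm w)\<^sup>2"
      using tendsto_Re[OF cinner.tendsto[OF w tendsto_const[of w]]] by (simp add: cinner_self)
    show "(\<lambda>n. C * norm (L (v n))) \<longlonglongrightarrow> C * norm w"
      by (intro tendsto_intros w)
    have "Re (cinner (L (v n)) w) \<le> C * norm (L (v n))" for n
      using bound[of "v n"] rep[of "v n"] by simp
    then show "\<exists>N. \<forall>n\<ge>N. Re (cinner (L (v n)) w) \<le> C * norm (L (v n))"
      by blast
  qed
  then have "norm w \<le> C"
    using C by (cases "w = 0") (simp_all add: power2_eq_square)
  with w_closure show ?thesis by (intro bexI[of _ w] conjI allI rep)
qed

text \<open>A complex-linear functional is determined by its real part, since the real part at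
  \<open>\<i> *\<^sub>C v\<close> is minus the imaginary part at \<open>v\<close>.\<close>

lemma Riesz_closure_range:
  fixes L :: "'b::complex_hilbert \<Rightarrow> 'a::complex_hilbert" and f :: "'b \<Rightarrow> complex"
  assumes L: "\<And>u v. L (u + v) = L u + L v" "\<And>c v. L (c *\<^sub>C v) = c *\<^sub>C L v"
    and f: "\<And>u v. f (u + v) = f u + f v" "\<And>c v. f (c *\<^sub>C v) = c * f v"
    and bound: "\<And>v. \<bar>Re (f v)\<bar> \<le> C * norm (L v)" and C: "0 \<le> C"
  shows "\<exists>w\<in>closure (range L). norm w \<le> C \<and> (\<forall>v. f v = cinner (L v) w)"
proof -
  have "linear L" by (rule linearI) (simp_all add: L scaleR_scaleC)
  moreover have "linear (\<lambda>v. Re (f v))" by (rule linearI) (simp_all add: f scaleR_scaleC)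
  ultimately obtain w where w: "w \<in> closure (range L)" "norm w \<le> C"
    and rep: "\<And>v. Re (f v) = Re (cinner (L v) w)"
    using Riesz_closure_range_real[of L "\<lambda>v. Re (f v)" C] bound C by blast
  have "Im (f v) = Im (cinner (L v) w)" for v
    using rep[of "\<i> *\<^sub>C v"] by (simp add: f L cinner_scaleC_left)
  with rep w show ?thesis by (intro bexI[of _ w] conjI allI complex_eqI)
qed

section \<open>Self-adjoint operators\<close>

text \<open>Stated through the inner product because this form passes to limits and avoids the
  choice hidden in \<open>adj_op\<close>.\<close>

definition selfadjoint :: "('a::complex_hilbert \<Rightarrow>\<^sub>L 'a) \<Rightarrow> bool"
  where "selfadjoint A \<longleftrightarrow> (\<forall>x y. cinner (A x) y = cinner x (A y))"

lemma selfadjointD: "selfadjoint A \<Longrightarrow> cinner (A x) y = cinner x (A y)"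
  by (simp add: selfadjoint_def)

lemma bounded_ops_scaleC: "A \<in> bounded_ops \<Longrightarrow> A (c *\<^sub>C x) = c *\<^sub>C A x"
  by (simp add: bounded_ops_def)

text \<open>Symmetry moves the scalar into the second argument of the inner product, where it can be
  pulled out. Complex linearity thus comes for free with self-adjointness, for instance for limits
  of iterations.\<close>

lemma selfadjoint_bounded_ops:
  assumes "selfadjoint A"
  shows "A \<in> bounded_ops"
  unfolding bounded_ops_def
proof (intro CollectI allI)
  fix c x
  show "A (c *\<^sub>C x) = c *\<^sub>C A x"
  proof (rule cinner_ext)
    fix y
    show "cinner y (A (c *\<^sub>C x)) = cinner y (c *\<^sub>C A x)"
      using assms by (simp add: cinner_scaleC_right flip: selfadjointD)
  qed
qed

text \<open>Riesz with \<open>L\<close> the identity represents each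
  \<open>x \<mapsto> cinner (A x) y\<close>; the norm bound makes the representing vector a bounded
  function of \<open>y\<close>, and nondegeneracy makes it linear.\<close>

lemma adjoint_exists:
  fixes A :: "'a::complex_hilbert \<Rightarrow>\<^sub>L 'a"
  assumes A: "A \<in> bounded_ops"
  shows "\<exists>B. B \<in> bounded_ops \<and> (\<forall>x y. cinner (A x) y = cinner x (B y))"
proof -
  have "\<exists>w. norm w \<le> norm A * norm y \<and> (\<forall>x. cinner (A x) y = cinner x w)" for y
  proof -
    have "\<bar>Re (cinner (A x) y)\<bar> \<le> (norm A * norm y) * norm x" for x
    proof -
      have "\<bar>Re (cinner (A x) y)\<bar> \<le> norm (A x) * norm y"
        using abs_Re_le_cmod norm_cinner_le by (rule order_trans)
      also have "\<dots> \<le> (norm A * norm x) * norm y"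
        by (intro mult_right_mono norm_blinfun) simp
      finally show ?thesis by (simp add: mult_ac)
    qed
    then show ?thesis
      using Riesz_closure_range[of "\<lambda>x. x" "\<lambda>x. cinner (A x) y" "norm A * norm y"] A
      by (auto simp: blinfun.add_right cinner.add_left bounded_ops_scaleC cinner_scaleC_left)
  qed
  then obtain B where B_norm: "\<And>y. norm (B y) \<le> norm A * norm y"
    and B: "\<And>x y. cinner (A x) y = cinner x (B y)"
    by metis
  have add: "B (y + z) = B y + B z" for y z
    by (rule cinner_ext) (simp add: cinner.add_right flip: B)
  have scale: "B (c *\<^sub>C y) = c *\<^sub>C B y" for c y
    by (rule cinner_ext) (simp add: cinner_scaleC_right flip: B)
  have "bounded_linear B"
    by (rule bounded_linear_intro[of _ "norm A"])
       (simp_all add: add scale scaleR_scaleC mult.commute[of _ "norm A"] B_norm)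
  then have "blinfun_apply (Blinfun B) = B" by (rule bounded_linear_Blinfun_apply)
  then show ?thesis
    using B scale by (intro exI[of _ "Blinfun B"]) (simp add: bounded_ops_def)
qed

lemma selfadjoint_if_adj_op:
  assumes "A \<in> bounded_ops" and "A = adj_op A"
  shows "selfadjoint A"
  using someI_ex[OF adjoint_exists[OF assms(1)]] assms(2)
  unfolding adj_op_def selfadjoint_def by simp

lemma selfadjoint_cinner_real:
  assumes "selfadjoint A"
  shows "Im (cinner (A x) x) = 0"
proof -
  have "cnj (cinner (A x) x) = cinner (A x) x"
    by (subst cinner_commute[symmetric], subst selfadjointD[OF assms]) (rule refl)
  then show ?thesis by (simp add: complex_eq_iff)
qed

lemma positive_op_iff:
  assumes "selfadjoint A"
  shows "positive_op A \<longleftrightarrow> (\<forall>x. 0 \<le> Re (cinner (A x) x))"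
  by (simp add: positive_op_def complex_nonneg_Reals_iff selfadjoint_cinner_real[OF assms])

lemma selfadjoint_add: "selfadjoint A \<Longrightarrow> selfadjoint B \<Longrightarrow> selfadjoint (A + B)"
  by (simp add: selfadjoint_def blinfun.add_left cinner.add_left cinner.add_right)

lemma selfadjoint_diff: "selfadjoint A \<Longrightarrow> selfadjoint B \<Longrightarrow> selfadjoint (A - B)"
  by (simp add: selfadjoint_def blinfun.diff_left cinner.diff_left cinner.diff_right)

lemma selfadjoint_minus: "selfadjoint A \<Longrightarrow> selfadjoint (- A)"
  by (simp add: selfadjoint_def blinfun.minus_left cinner.minus_left cinner.minus_right)

lemma selfadjoint_id: "selfadjoint id_blinfun"
  by (simp add: selfadjoint_def)

text \<open>A real quadratic form makes the sesquilinear defect \<open>\<phi>\<close> vanish on the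
  diagonal, and complex polarization then kills it. This gives symmetry of the root chosen by
  \<open>sqrt_op\<close>, of which only positivity is prescribed.\<close>

lemma positive_op_selfadjoint:
  assumes "A \<in> bounded_ops" and "positive_op A"
  shows "selfadjoint A"
  unfolding selfadjoint_def
proof (intro allI)
  define \<phi> where "\<phi> x y = cinner (A x) y - cinner x (A y)" for x y
  have diag: "\<phi> x x = 0" for x
  proof -
    have "Im (cinner (A x) x) = 0"
      using assms(2) by (simp add: positive_op_def complex_nonneg_Reals_iff)
    then show ?thesis
      unfolding \<phi>_def using cinner_commute[of x "A x"] by (simp add: complex_eq_iff)
  qed
  fix x y
  have "\<phi> x y + \<phi> y x = 0"
    using diag[of "x + y"] diag[of x] diag[of y]
    by (simp add: \<phi>_def blinfun.add_right cinner.add_left cinner.add_right algebra_simps)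
  \<comment> \<open>The factor \<open>\<i>\<close> leaves the second slot conjugated, which turns
    the sum of the two values into their difference.\<close>
  moreover have "\<phi> (\<i> *\<^sub>C x) y + \<phi> y (\<i> *\<^sub>C x) = 0"
    using diag[of "\<i> *\<^sub>C x + y"] diag[of "\<i> *\<^sub>C x"] diag[of y]
    by (simp add: \<phi>_def blinfun.add_right cinner.add_left cinner.add_right algebra_simps)
  then have "\<i> * (\<phi> x y - \<phi> y x) = 0"
    using assms(1)
    by (simp add: \<phi>_def bounded_ops_scaleC cinner_scaleC_left cinner_scaleC_right algebra_simps)
  ultimately have "\<phi> x y = 0"
    by (simp add: add_eq_0_iff)
  then show "cinner (A x) y = cinner x (A y)" by (simp add: \<phi>_def)
qed

text \<open>Polarizing at \<open>x\<close> and \<open>y = A x\<close> writes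
  \<open>4 * (norm y)\<^sup>2\<close> as a difference of two values of the quadratic form; the
  parallelogram law bounds it by \<open>2 * (norm x)\<^sup>2 + 2 * (norm y)\<^sup>2\<close>.\<close>

lemma selfadjoint_norm_le_one:
  fixes A :: "'a::complex_hilbert \<Rightarrow>\<^sub>L 'a"
  assumes A: "selfadjoint A" and "le_op A id_blinfun" and "le_op (- A) id_blinfun"
  shows "norm A \<le> 1"
proof (rule norm_blinfun_bound)
  have bound: "\<bar>Re (cinner (A z) z)\<bar> \<le> (norm z)\<^sup>2" for z
  proof -
    have "0 \<le> Re (cinner ((id_blinfun - A) z) z)" "0 \<le> Re (cinner ((id_blinfun - (- A)) z) z)"
      using assms(2,3) by (simp_all add: le_op_def positive_op_def complex_nonneg_Reals_iff)
    then show ?thesis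
      by (simp add: blinfun.diff_left blinfun.add_left cinner.diff_left cinner.add_left
          cinner_self[of z] abs_le_iff)
  qed
  fix x
  define y where "y = A x"
  have "cinner (A y) x = cinner y y" using A by (simp add: y_def selfadjointD)
  then have "4 * (norm y)\<^sup>2 = Re (cinner (A (x + y)) (x + y)) - Re (cinner (A (x - y)) (x - y))"
    by (simp add: blinfun.add_right blinfun.diff_right cinner.add_left cinner.add_right
        cinner.diff_left cinner.diff_right cinner_self flip: y_def)
  also have "\<dots> \<le> (norm (x + y))\<^sup>2 + (norm (x + (- y)))\<^sup>2"
    using bound[of "x + y"] bound[of "x - y"] by simp
  also have "\<dots> = 2 * (norm x)\<^sup>2 + 2 * (norm y)\<^sup>2"
    unfolding norm_add_square by (simp add: cinner.minus_right)
  finally have "(norm y)\<^sup>2 \<le> (norm x)\<^sup>2" by simp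
  then show "norm (A x) \<le> 1 * norm x"
    by (simp add: y_def)
qed simp

section \<open>Square roots\<close>

text \<open>
  If \<open>Y = (X + Y\<^sup>2) / 2\<close> then \<open>(1 - Y)\<^sup>2 = 1 - X\<close>. For \<open>\<parallel>X\<parallel> \<le> 1\<close> the fixed point iteration
  converges in norm, because its steps are dominated by those of the same iteration for the
  number 1.
\<close>

primrec sqrt_iter :: "('a::real_normed_vector \<Rightarrow>\<^sub>L 'a) \<Rightarrow> nat \<Rightarrow> 'a \<Rightarrow>\<^sub>L 'a"
  where
    "sqrt_iter X 0 = 0"
  | "sqrt_iter X (Suc n) = (1/2) *\<^sub>R (X + (sqrt_iter X n o\<^sub>L sqrt_iter X n))"

primrec scalar_iter :: "nat \<Rightarrow> real"
  where
    "scalar_iter 0 = 0"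
  | "scalar_iter (Suc n) = (1/2) * (1 + scalar_iter n * scalar_iter n)"

lemma scalar_iter_nonneg: "0 \<le> scalar_iter n"
  by (induction n) simp_all

lemma scalar_iter_le_one: "scalar_iter n \<le> 1"
proof (induction n)
  case (Suc n)
  then have "scalar_iter n * scalar_iter n \<le> 1"
    by (intro mult_le_one scalar_iter_nonneg)
  then show ?case by simp
qed simp

text \<open>The increment is half the square of \<open>1 - scalar_iter n\<close>.\<close>

lemma scalar_iter_step: "scalar_iter n \<le> scalar_iter (Suc n)"
proof -
  have "0 \<le> (1 - scalar_iter n) * (1 - scalar_iter n)" by (rule zero_le_square)
  then show ?thesis by (simp add: algebra_simps)
qed

lemma scalar_iter_convergent: "convergent scalar_iter"
proof -
  have "incseq scalar_iter" by (rule incseq_SucI) (rule scalar_iter_step)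
  moreover have "\<forall>n. scalar_iter n \<le> 1" by (simp add: scalar_iter_le_one)
  ultimately obtain l where "scalar_iter \<longlonglongrightarrow> l"
    by (rule incseq_convergent)
  then show ?thesis by (rule convergentI)
qed

lemma norm_sqrt_iter_le:
  assumes "norm X \<le> 1"
  shows "norm (sqrt_iter X n) \<le> scalar_iter n"
proof (induction n)
  case (Suc n)
  have "norm (X + (sqrt_iter X n o\<^sub>L sqrt_iter X n)) \<le> 1 + scalar_iter n * scalar_iter n"
    by (intro norm_triangle_mono assms order_trans[OF norm_blinfun_compose] mult_mono Suc
        scalar_iter_nonneg norm_ge_zero)
  then show ?case by simp
qed simp

lemma norm_sqrt_iter_step:
  assumes "norm X \<le> 1"
  shows "norm (sqrt_iter X (Suc n) - sqrt_iter X n) \<le> scalar_iter (Suc n) - scalar_iter n"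
proof (induction n)
  case 0
  then show ?case using assms by simp
next
  case (Suc n)
  define Y Z y z where "Y = sqrt_iter X (Suc n)" and "Z = sqrt_iter X n"
    and "y = scalar_iter (Suc n)" and "z = scalar_iter n"
  have Y: "norm Y \<le> y" and Z: "norm Z \<le> z" and YZ: "norm (Y - Z) \<le> y - z"
    using norm_sqrt_iter_le[OF assms] Suc by (simp_all only: Y_def Z_def y_def z_def)
  have pos: "0 \<le> y" "0 \<le> z" by (simp_all only: y_def z_def scalar_iter_nonneg)
  \<comment> \<open>This splitting respects the order of the factors; its scalar counterpart is an
    equality, so the domination carries over term by term.\<close>
  have "(Y o\<^sub>L Y) - (Z o\<^sub>L Z) = (Y o\<^sub>L (Y - Z)) + ((Y - Z) o\<^sub>L Z)"
    by (rule blinfun_eqI) (simp add: blinfun.diff_left blinfun.diff_right blinfun.add_left)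
  then have "norm ((Y o\<^sub>L Y) - (Z o\<^sub>L Z)) \<le> y * (y - z) + (y - z) * z"
    using Y Z YZ pos
    by (auto intro!: norm_triangle_mono order_trans[OF norm_blinfun_compose] mult_mono
        intro: order_trans[OF norm_ge_zero])
  moreover have "sqrt_iter X (Suc (Suc n)) - sqrt_iter X (Suc n) = (1/2) *\<^sub>R ((Y o\<^sub>L Y) - (Z o\<^sub>L Z))"
    unfolding sqrt_iter.simps(2)[of X "Suc n"] Y_def[symmetric]
    by (subst (3) Y_def) (simp add: Z_def scaleR_diff_right scaleR_add_right)
  moreover have "scalar_iter (Suc (Suc n)) - scalar_iter (Suc n) = (1/2) * (y * (y - z) + (y - z) * z)"
    unfolding scalar_iter.simps(2)[of "Suc n"] y_def[symmetric]
    by (subst (3) y_def) (simp add: z_def algebra_simps)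
  ultimately show ?case by simp
qed

lemma norm_sqrt_iter_diff:
  assumes "norm X \<le> 1" and "m \<le> n"
  shows "norm (sqrt_iter X n - sqrt_iter X m) \<le> scalar_iter n - scalar_iter m"
  using assms(2)
proof (induction n rule: dec_induct)
  case (step n)
  have "norm (sqrt_iter X (Suc n) - sqrt_iter X m) \<le>
      norm (sqrt_iter X (Suc n) - sqrt_iter X n) + norm (sqrt_iter X n - sqrt_iter X m)"
    by (rule norm_diff_triangle_le[OF order_refl order_refl])
  with step.IH norm_sqrt_iter_step[OF assms(1), of n] show ?case by linarith
qed simp

lemma sqrt_iter_convergent:
  fixes X :: "'a::banach \<Rightarrow>\<^sub>L 'a"
  assumes "norm X \<le> 1"
  shows "convergent (sqrt_iter X)"
proof -
  have "Cauchy (sqrt_iter X)"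
  proof (rule metric_CauchyI)
    fix e :: real assume "0 < e"
    have "Cauchy scalar_iter" using scalar_iter_convergent by (rule convergent_Cauchy)
    from metric_CauchyD[OF this \<open>0 < e\<close>] obtain N
      where N: "\<And>m n. m \<ge> N \<Longrightarrow> n \<ge> N \<Longrightarrow> dist (scalar_iter m) (scalar_iter n) < e"
      by blast
    have less: "dist (sqrt_iter X m) (sqrt_iter X n) < e" if "N \<le> m" "m \<le> n" for m n
    proof -
      have "dist (sqrt_iter X m) (sqrt_iter X n) \<le> scalar_iter n - scalar_iter m"
        using norm_sqrt_iter_diff[OF assms \<open>m \<le> n\<close>] by (simp add: dist_norm norm_minus_commute)
      also have "\<dots> < e" using N[of m n] that by (simp add: dist_real_def)
      finally show ?thesis .
    qed
    show "\<exists>M. \<forall>m\<ge>M. \<forall>n\<ge>M. dist (sqrt_iter X m) (sqrt_iter X n) < e"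
    proof (intro exI allI impI)
      fix m n assume "N \<le> m" "N \<le> n"
      then show "dist (sqrt_iter X m) (sqrt_iter X n) < e"
        using less[of m n] less[of n m] by (cases "m \<le> n") (simp_all add: dist_commute)
    qed
  qed
  then show ?thesis by (rule Cauchy_convergent)
qed

lemma selfadjoint_sqrt_iter:
  assumes "selfadjoint X"
  shows "selfadjoint (sqrt_iter X n)"
proof (induction n)
  case 0
  show ?case by (simp add: selfadjoint_def cinner.zero_left cinner.zero_right)
next
  case (Suc n)
  with assms show ?case
    by (simp add: selfadjoint_def blinfun.scaleR_left blinfun.add_left cinner.add_left
        cinner.add_right cinner.scaleR_left cinner.scaleR_right)
qed

text \<open>The root is \<open>id_blinfun - Y\<close> for the limit \<open>Y\<close> of the
  iteration. It is symmetric because every iterate is, and positive because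
  \<open>norm Y \<le> 1\<close>.\<close>

lemma sqrt_exists:
  fixes X :: "'a::complex_hilbert \<Rightarrow>\<^sub>L 'a"
  assumes X: "selfadjoint X" and norm_X: "norm X \<le> 1"
  shows "\<exists>S. S \<in> bounded_ops \<and> positive_op S \<and> S o\<^sub>L S = id_blinfun - X"
proof -
  obtain Y where Y: "sqrt_iter X \<longlonglongrightarrow> Y"
    using sqrt_iter_convergent[OF norm_X] by (auto simp: convergent_def)
  have Y_apply: "(\<lambda>n. sqrt_iter X n x) \<longlonglongrightarrow> Y x" for x
    by (intro tendsto_intros Y)
  have sa: "selfadjoint Y"
    unfolding selfadjoint_def
  proof (intro allI)
    fix x y
    have "(\<lambda>n. cinner (sqrt_iter X n x) y) \<longlonglongrightarrow> cinner (Y x) y"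
      "(\<lambda>n. cinner x (sqrt_iter X n y)) \<longlonglongrightarrow> cinner x (Y y)"
      by (intro cinner.tendsto Y_apply tendsto_const)+
    then show "cinner (Y x) y = cinner x (Y y)"
      using selfadjointD[OF selfadjoint_sqrt_iter[OF X]] by (auto intro: LIMSEQ_unique)
  qed
  have norm_Y: "norm Y \<le> 1"
    using norm_sqrt_iter_le[OF norm_X] scalar_iter_le_one
    by (intro LIMSEQ_le_const2[OF tendsto_norm[OF Y]]) (blast intro: order_trans)
  have "(\<lambda>n. sqrt_iter X (Suc n)) \<longlonglongrightarrow> (1/2) *\<^sub>R (X + (Y o\<^sub>L Y))"
    unfolding sqrt_iter.simps
    by (intro tendsto_intros bounded_bilinear.tendsto[OF bounded_bilinear_blinfun_compose] Y)
  then have "Y = (1/2) *\<^sub>R (X + (Y o\<^sub>L Y))"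
    using LIMSEQ_Suc[OF Y] by (rule LIMSEQ_unique[rotated])
  then have "2 *\<^sub>R Y = 2 *\<^sub>R ((1/2) *\<^sub>R (X + (Y o\<^sub>L Y)))" by (rule arg_cong)
  then have fixpoint: "X + (Y o\<^sub>L Y) = Y + Y" by (simp add: scaleR_2)
  have "(id_blinfun - Y) o\<^sub>L (id_blinfun - Y) = id_blinfun - X"
  proof (rule blinfun_eqI)
    fix x
    have "X x + Y (Y x) = Y x + Y x"
      using arg_cong[OF fixpoint, of "\<lambda>A. blinfun_apply A x"] by (simp add: blinfun.add_left)
    then show "((id_blinfun - Y) o\<^sub>L (id_blinfun - Y)) x = (id_blinfun - X) x"
      by (simp add: blinfun.diff_left blinfun.diff_right algebra_simps)
  qed
  moreover have sa': "selfadjoint (id_blinfun - Y)"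
    by (intro selfadjoint_diff selfadjoint_id sa)
  moreover have "positive_op (id_blinfun - Y)"
    unfolding positive_op_iff[OF sa']
  proof
    fix x
    have "Re (cinner (Y x) x) \<le> norm (Y x) * norm x" by (rule Re_cinner_le)
    also have "\<dots> \<le> (norm Y * norm x) * norm x"
      by (intro mult_right_mono norm_blinfun) simp
    also have "\<dots> \<le> (1 * norm x) * norm x"
      by (intro mult_right_mono norm_Y) simp_all
    finally show "0 \<le> Re (cinner ((id_blinfun - Y) x) x)"
      by (simp add: blinfun.diff_left cinner.diff_left cinner_self[of x] power2_eq_square)
  qed
  ultimately show ?thesis
    by (intro exI[of _ "id_blinfun - Y"] conjI selfadjoint_bounded_ops)
qed

text \<open>Writing the operator as \<open>id_blinfun - X\<close> covers both signs, with
  \<open>X = T2\<close> and \<open>X = - T2\<close>.\<close>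

lemma sqrt_op_id_minus:
  fixes X :: "'a::complex_hilbert \<Rightarrow>\<^sub>L 'a"
  assumes "selfadjoint X" and "norm X \<le> 1"
  shows "selfadjoint (sqrt_op (id_blinfun - X))"
    and "sqrt_op (id_blinfun - X) o\<^sub>L sqrt_op (id_blinfun - X) = id_blinfun - X"
proof -
  note * = someI_ex[OF sqrt_exists[OF assms], folded sqrt_op_def]
  from * show "selfadjoint (sqrt_op (id_blinfun - X))" by (blast intro: positive_op_selfadjoint)
  from * show "sqrt_op (id_blinfun - X) o\<^sub>L sqrt_op (id_blinfun - X) = id_blinfun - X" by blast
qed

section \<open>Factorization through a square root\<close>

text \<open>The kernel of a self-adjoint operator is orthogonal to its range, so
  \<open>w - z\<close> is orthogonal to a space containing both \<open>w\<close> and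
  \<open>z\<close>.\<close>

lemma selfadjoint_inj_on_closure_range:
  assumes S: "selfadjoint S" and w: "w \<in> closure (range S)" and z: "z \<in> closure (range S)"
    and eq: "S w = S z"
  shows "w = z"
proof -
  have orth: "cinner x (w - z) = 0" if "x \<in> closure (range S)" for x
    using that
  proof (rule cinner_closure_eq_zero)
    fix x assume "x \<in> range S"
    then show "cinner x (w - z) = 0"
      using S eq by (auto simp: selfadjointD cinner.diff_right)
  qed
  have "cinner (w - z) (w - z) = 0"
    using orth[OF w] orth[OF z] by (simp add: cinner.diff_left)
  then show ?thesis by (simp add: cinner_eq_zero_iff)
qed

text \<open>Bridges the closed range of \<open>I \<plusminus> T2\<close> and that of its root. A
  vector \<open>S y\<close> is shown to equal its projection onto the smaller space by cancelling
  \<open>S\<close> twice.\<close>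

lemma closure_range_square:
  fixes S :: "'a::complex_hilbert \<Rightarrow>\<^sub>L 'a"
  assumes S: "selfadjoint S"
  shows "closure (range (S o\<^sub>L S)) = closure (range S)"
proof
  have scale: "S (c *\<^sub>C v) = c *\<^sub>C S v" for c v
    using S by (intro bounded_ops_scaleC selfadjoint_bounded_ops)
  show sub: "closure (range (S o\<^sub>L S)) \<subseteq> closure (range S)"
    by (rule closure_mono) auto
  have "range S \<subseteq> closure (range (S o\<^sub>L S))"
  proof
    fix x assume x: "x \<in> range S"
    \<comment> \<open>The representing vector \<open>p\<close> is the orthogonal projection of
      \<open>x\<close> onto the closed range of the square.\<close>
    have "\<exists>p\<in>closure (range (S o\<^sub>L S)). norm p \<le> norm x \<and>
        (\<forall>v. cinner ((S o\<^sub>L S) v) x = cinner ((S o\<^sub>L S) v) p)"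
    proof (rule Riesz_closure_range)
      show "\<bar>Re (cinner ((S o\<^sub>L S) v) x)\<bar> \<le> norm x * norm ((S o\<^sub>L S) v)" for v
        using order_trans[OF abs_Re_le_cmod norm_cinner_le, of "(S o\<^sub>L S) v" x]
        by (simp add: mult.commute)
    qed (simp_all add: blinfun.add_right scale cinner.add_left cinner_scaleC_left)
    then obtain p where p: "p \<in> closure (range (S o\<^sub>L S))"
      and rep: "\<And>v. cinner ((S o\<^sub>L S) v) x = cinner ((S o\<^sub>L S) v) p"
      by metis
    have in_closure: "S v \<in> closure (range S)" for v
      using closure_subset[of "range S"] by auto
    have "S (S x) = S (S p)"
      by (rule cinner_ext) (use rep in \<open>simp flip: selfadjointD[OF S]\<close>)
    then have "S x = S p"
      by (rule selfadjoint_inj_on_closure_range[OF S in_closure in_closure])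
    then have "x = p"
      by (rule selfadjoint_inj_on_closure_range[OF S subsetD[OF closure_subset x] subsetD[OF sub p]])
    with p show "x \<in> closure (range (S o\<^sub>L S))" by simp
  qed
  then show "closure (range S) \<subseteq> closure (range (S o\<^sub>L S))"
    by (simp add: closure_minimal)
qed

lemma contraction_factor_exists:
  fixes S B :: "'a::complex_hilbert \<Rightarrow>\<^sub>L 'a"
  assumes S: "selfadjoint S" and B: "selfadjoint B"
    and nonneg: "\<And>u v. 0 \<le> (norm (S u))\<^sup>2 + (norm (S v))\<^sup>2 + 2 * Re (cinner (B u) v)"
  shows "\<exists>\<Gamma>. contraction_on (closure (range S)) \<Gamma> \<and> (\<forall>x. B x = S (\<Gamma> (S x)))"
proof -
  define K where "K = closure (range S)"
  have S_in_K: "S x \<in> K" for x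
    using closure_subset[of "range S"] by (auto simp: K_def)
  note S_add = blinfun.add_right[of S] and B_add = blinfun.add_right[of B]
  have S_scale: "S (c *\<^sub>C v) = c *\<^sub>C S v" and B_scale: "B (c *\<^sub>C v) = c *\<^sub>C B v" for c v
    using S B by (simp_all add: bounded_ops_scaleC selfadjoint_bounded_ops)
  \<comment> \<open>Uniqueness of representing vectors in \<open>K\<close>, from which the linearity
    of \<open>W\<close> and of \<open>\<Gamma>\<close> follows.\<close>
  have determined: "w = z" if "w \<in> K" "z \<in> K" "\<And>v. cinner (S v) w = cinner (S v) z" for w z
  proof (rule selfadjoint_inj_on_closure_range[OF S])
    show "S w = S z" by (rule cinner_ext) (use that(3) S in \<open>simp add: selfadjointD\<close>)
  qed (use that in \<open>simp_all add: K_def\<close>)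
  have bound: "\<bar>Re (cinner (B u) v)\<bar> \<le> norm (S u) * norm (S v)" for u v
  proof -
    \<comment> \<open>Scaling \<open>v\<close> turns the sum of squares in the hypothesis into a
      product bound.\<close>
    have "0 \<le> (norm (S u))\<^sup>2 + 2 * t * Re (cinner (B u) v) + t\<^sup>2 * (norm (S v))\<^sup>2" for t
      using nonneg[of u "t *\<^sub>R v"]
      by (simp add: blinfun.scaleR_right cinner.scaleR_right power_mult_distrib algebra_simps)
    then have "(Re (cinner (B u) v))\<^sup>2 \<le> (norm (S u) * norm (S v))\<^sup>2"
      unfolding power_mult_distrib by (rule quadratic_nonneg_imp) simp
    then have "\<bar>Re (cinner (B u) v)\<bar> \<le> \<bar>norm (S u) * norm (S v)\<bar>"
      by (rule abs_le_square_iff[THEN iffD2])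
    then show ?thesis by simp
  qed
  \<comment> \<open>The first division: \<open>S (W u) = B u\<close>, as \<open>B\<close> and
    \<open>S\<close> are self-adjoint.\<close>
  have "\<exists>w\<in>K. norm w \<le> norm (S u) \<and> (\<forall>v. cinner (B v) u = cinner (S v) w)" for u
    unfolding K_def
  proof (rule Riesz_closure_range)
    show "\<bar>Re (cinner (B v) u)\<bar> \<le> norm (S u) * norm (S v)" for v
      using bound[of v u] by (simp add: mult.commute)
  qed (simp_all add: S_add S_scale B_add B_scale cinner.add_left cinner_scaleC_left)
  then obtain W where W: "\<And>u. W u \<in> K" "\<And>u. norm (W u) \<le> norm (S u)"
    and W_rep: "\<And>u v. cinner (B v) u = cinner (S v) (W u)"
    by metis
  have K_add: "w + z \<in> K" if "w \<in> K" "z \<in> K" for w z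
  proof -
    obtain s t where st: "\<And>n. s n \<in> range S" "s \<longlonglongrightarrow> w" "\<And>n. t n \<in> range S" "t \<longlonglongrightarrow> z"
      using \<open>w \<in> K\<close> \<open>z \<in> K\<close> by (auto simp: K_def closure_sequential)
    have "s n + t n \<in> range S" for n using st(1)[of n] st(3)[of n] by (auto simp flip: S_add)
    with tendsto_add[OF st(2,4)] show ?thesis
      unfolding K_def closure_sequential by (intro exI[of _ "\<lambda>n. s n + t n"]) simp
  qed
  have K_scale: "c *\<^sub>C w \<in> K" if w: "w \<in> K" for c w
  proof -
    obtain s where s: "\<And>n. s n \<in> range S" "s \<longlonglongrightarrow> w"
      using w by (auto simp: K_def closure_sequential)
    have "bounded_linear (\<lambda>x::'a. c *\<^sub>C x)"
      by (rule bounded_linear_intro[of _ "cmod c"])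
         (simp_all add: scaleC_add_right scaleR_scaleC scaleC_scaleC norm_scaleC mult.commute)
    then have "(\<lambda>n. c *\<^sub>C s n) \<longlonglongrightarrow> c *\<^sub>C w" using s(2) by (rule bounded_linear.tendsto)
    moreover have "c *\<^sub>C s n \<in> range S" for n using s(1)[of n] by (auto simp flip: S_scale)
    ultimately show ?thesis
      unfolding K_def closure_sequential by (intro exI[of _ "\<lambda>n. c *\<^sub>C s n"]) simp
  qed
  have W_add: "W (u + v) = W u + W v" for u v
    by (rule determined) (simp_all add: W K_add cinner.add_right flip: W_rep)
  have W_scale: "W (c *\<^sub>C u) = c *\<^sub>C W u" for c u
    by (rule determined) (simp_all add: W K_scale cinner_scaleC_right flip: W_rep)
  \<comment> \<open>The second division, now of the formal adjoint of \<open>W\<close>. The estimate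
    \<open>norm (W v) \<le> norm (S v)\<close> is what makes \<open>\<Gamma>\<close> a
    contraction.\<close>
  have "\<exists>w\<in>K. norm w \<le> norm x \<and> (\<forall>v. cinner (W v) x = cinner (S v) w)" for x
    unfolding K_def
  proof (rule Riesz_closure_range)
    show "\<bar>Re (cinner (W v) x)\<bar> \<le> norm x * norm (S v)" for v
    proof -
      have "\<bar>Re (cinner (W v) x)\<bar> \<le> norm (W v) * norm x"
        using abs_Re_le_cmod norm_cinner_le by (rule order_trans)
      also have "\<dots> \<le> norm (S v) * norm x" by (intro mult_right_mono W) simp
      finally show ?thesis by (simp add: mult.commute)
    qed
  qed (simp_all add: S_add S_scale W_add W_scale cinner.add_left cinner_scaleC_left)
  then obtain \<Gamma> where \<Gamma>: "\<And>x. \<Gamma> x \<in> K" "\<And>x. norm (\<Gamma> x) \<le> norm x"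
    and \<Gamma>_rep: "\<And>x v. cinner (W v) x = cinner (S v) (\<Gamma> x)"
    by metis
  have "contraction_on K \<Gamma>"
    unfolding contraction_on_def
  proof (intro conjI allI ballI)
    show "\<Gamma> (x + y) = \<Gamma> x + \<Gamma> y" for x y
      by (rule determined) (simp_all add: \<Gamma> K_add cinner.add_right flip: \<Gamma>_rep)
    show "\<Gamma> (c *\<^sub>C x) = c *\<^sub>C \<Gamma> x" for c x
      by (rule determined) (simp_all add: \<Gamma> K_scale cinner_scaleC_right flip: \<Gamma>_rep)
  qed (use \<Gamma> in auto)
  moreover have "B x = S (\<Gamma> (S x))" for x
  proof (rule cinner_ext)
    fix v
    have "cinner v (S (\<Gamma> (S x))) = cinner (W v) (S x)"
      unfolding \<Gamma>_rep by (rule selfadjointD[OF S, symmetric])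
    also have "\<dots> = cnj (cinner (B x) v)"
      by (subst cinner_commute) (simp add: W_rep)
    also have "\<dots> = cinner v (B x)" by (rule cinner_commute[symmetric])
    finally show "cinner v (B x) = cinner v (S (\<Gamma> (S x)))" by simp
  qed
  ultimately show ?thesis unfolding K_def by (intro exI[of _ \<Gamma>] conjI allI)
qed

text \<open>Since \<open>cinner (B u) v = cinner (\<Gamma> (S u)) (S v)\<close>, Cauchy-Schwarz and
  the inequality of arithmetic and geometric means suffice.\<close>

lemma contraction_factor_nonneg:
  assumes S: "selfadjoint S" and \<Gamma>: "contraction_on (closure (range S)) \<Gamma>"
    and B: "\<And>x. B x = S (\<Gamma> (S x))"
  shows "0 \<le> (norm (S u))\<^sup>2 + (norm (S v))\<^sup>2 + 2 * Re (cinner (B u) v)"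
proof -
  have "- Re (cinner (B u) v) = Re (cinner (\<Gamma> (S u)) (- S v))"
    using S by (simp add: B selfadjointD cinner.minus_right)
  also have "\<dots> \<le> norm (\<Gamma> (S u)) * norm (- S v)" by (rule Re_cinner_le)
  also have "\<dots> \<le> norm (S u) * norm (S v)"
  proof -
    have "S u \<in> closure (range S)" using closure_subset[of "range S"] by auto
    then have "norm (\<Gamma> (S u)) \<le> norm (S u)" using \<Gamma> by (simp add: contraction_on_def)
    then show ?thesis by (simp add: mult_right_mono)
  qed
  finally have "2 * (norm (S u) * norm (S v)) \<ge> - 2 * Re (cinner (B u) v)" by simp
  moreover have "0 \<le> (norm (S u) - norm (S v))\<^sup>2" by simp
  ultimately show ?thesis by (simp add: power2_diff)
qed

text \<open>Removes the root from the criterion: it has the same closed range as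
  \<open>id_blinfun - X\<close>, and \<open>(norm (S u))\<^sup>2\<close> is the quadratic form of
  \<open>id_blinfun - X\<close>.\<close>

lemma contraction_factor_iff:
  fixes X B :: "'a::complex_hilbert \<Rightarrow>\<^sub>L 'a"
  assumes X: "selfadjoint X" "norm X \<le> 1" and B: "selfadjoint B"
  shows "(\<exists>\<Gamma>. contraction_on (closure (range (id_blinfun - X))) \<Gamma> \<and>
      (\<forall>x. B x = sqrt_op (id_blinfun - X) (\<Gamma> (sqrt_op (id_blinfun - X) x)))) \<longleftrightarrow>
    (\<forall>u v. 0 \<le> Re (cinner ((id_blinfun - X) u) u) + Re (cinner ((id_blinfun - X) v) v)
      + 2 * Re (cinner (B u) v))"
proof -
  define S where "S = sqrt_op (id_blinfun - X)"
  note S = sqrt_op_id_minus[OF X, folded S_def]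
  have K: "closure (range (id_blinfun - X)) = closure (range S)"
    using closure_range_square[OF S(1)] by (simp only: S(2))
  have eq: "Re (cinner ((id_blinfun - X) u) u) = (norm (S u))\<^sup>2" for u
    unfolding S(2)[symmetric] using selfadjointD[OF S(1), of "S u" u] by (simp add: cinner_self)
  show ?thesis
    unfolding S_def[symmetric] K eq
  proof (intro iffI allI)
    fix u v
    assume "\<exists>\<Gamma>. contraction_on (closure (range S)) \<Gamma> \<and> (\<forall>x. B x = S (\<Gamma> (S x)))"
    then show "0 \<le> (norm (S u))\<^sup>2 + (norm (S v))\<^sup>2 + 2 * Re (cinner (B u) v)"
      using contraction_factor_nonneg[OF S(1)] by blast
  next
    assume "\<forall>u v. 0 \<le> (norm (S u))\<^sup>2 + (norm (S v))\<^sup>2 + 2 * Re (cinner (B u) v)"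
    then show "\<exists>\<Gamma>. contraction_on (closure (range S)) \<Gamma> \<and> (\<forall>x. B x = S (\<Gamma> (S x)))"
      by (intro contraction_factor_exists[OF S(1) B]) simp
  qed
qed

section \<open>The block matrix of the Klein four-group\<close>

lemma vector_4:
  "(vector [w, x, y, z] :: 'a::zero ^ 4) $ 1 = w"
  "(vector [w, x, y, z] :: 'a ^ 4) $ 2 = x"
  "(vector [w, x, y, z] :: 'a ^ 4) $ 3 = y"
  "(vector [w, x, y, z] :: 'a ^ 4) $ 4 = z"
  unfolding vector_def by simp_all

lemma cinner_block_op:
  "cinner (block_op M x) x = (\<Sum>i\<in>UNIV. \<Sum>j\<in>UNIV. cinner ((M $ i $ j) (x $ j)) (x $ i))"
  by (simp add: block_op_apply cinner_vec_def cinner.sum_left)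

text \<open>Makes the quadratic form real, so that positivity can be tested on real parts.\<close>

lemma selfadjoint_block_op:
  assumes "\<And>i j. selfadjoint (M $ i $ j)" and "\<And>i j. M $ i $ j = M $ j $ i"
  shows "selfadjoint (block_op M)"
  unfolding selfadjoint_def
proof (intro allI)
  fix x y
  have "cinner (block_op M x) y = (\<Sum>i\<in>UNIV. \<Sum>j\<in>UNIV. cinner (x $ j) ((M $ i $ j) (y $ i)))"
    by (simp add: block_op_apply cinner_vec_def cinner.sum_left selfadjointD[OF assms(1)])
  also have "\<dots> = (\<Sum>j\<in>UNIV. \<Sum>i\<in>UNIV. cinner (x $ j) ((M $ j $ i) (y $ i)))"
    by (subst sum.swap) (simp only: assms(2))
  also have "\<dots> = cinner x (block_op M y)"
    by (simp add: block_op_apply cinner_vec_def cinner.sum_right)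
  finally show "cinner (block_op M x) y = cinner x (block_op M y)" .
qed

text \<open>With rows and columns in the order e, a, b, ab, the entry in row t and column s is the
  value of the function at the product of the inverse of t with s.\<close>

definition Klein_matrix ::
  "('a::complex_hilbert \<Rightarrow>\<^sub>L 'a) \<Rightarrow> ('a \<Rightarrow>\<^sub>L 'a) \<Rightarrow> ('a \<Rightarrow>\<^sub>L 'a) \<Rightarrow> ('a \<Rightarrow>\<^sub>L 'a) ^ 4 ^ 4"
  where "Klein_matrix T1 T2 T3 = vector
      [vector [id_blinfun, T1, T2, T3],
       vector [T1, id_blinfun, T3, T2],
       vector [T2, T3, id_blinfun, T1],
       vector [T3, T2, T1, id_blinfun]]"

text \<open>For self-adjoint \<open>B\<close> the two off-diagonal terms have equal real parts,
  hence the factor 2.\<close>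

definition pair_form :: "('a::complex_hilbert \<Rightarrow>\<^sub>L 'a) \<Rightarrow> ('a \<Rightarrow>\<^sub>L 'a) \<Rightarrow> 'a \<Rightarrow> 'a \<Rightarrow> real"
  where "pair_form A B u v = Re (cinner (A u) u) + Re (cinner (A v) v) + 2 * Re (cinner (B u) v)"

lemma cinner_Klein_matrix:
  "cinner (block_op (Klein_matrix T1 T2 T3) x) x =
    cinner (x $ 1) (x $ 1) + cinner (T1 (x $ 2)) (x $ 1) + cinner (T2 (x $ 3)) (x $ 1) + cinner (T3 (x $ 4)) (x $ 1) +
    (cinner (T1 (x $ 1)) (x $ 2) + cinner (x $ 2) (x $ 2) + cinner (T3 (x $ 3)) (x $ 2) + cinner (T2 (x $ 4)) (x $ 2)) +
    (cinner (T2 (x $ 1)) (x $ 3) + cinner (T3 (x $ 2)) (x $ 3) + cinner (x $ 3) (x $ 3) + cinner (T1 (x $ 4)) (x $ 3)) +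
    (cinner (T3 (x $ 1)) (x $ 4) + cinner (T2 (x $ 2)) (x $ 4) + cinner (T1 (x $ 3)) (x $ 4) + cinner (x $ 4) (x $ 4))"
  by (simp add: cinner_block_op Klein_matrix_def sum_4 vector_4)

text \<open>
  The subgroup \<open>{e, b}\<close> acts by exchanging the coordinates 1, 3 and 2, 4; splitting along its two
  characters block-diagonalizes the matrix.
\<close>

lemma Re_cinner_Klein_matrix:
  fixes T1 T2 T3 :: "'a::complex_hilbert \<Rightarrow>\<^sub>L 'a"
  assumes T: "selfadjoint T1" "selfadjoint T2" "selfadjoint T3"
  shows "2 * Re (cinner (block_op (Klein_matrix T1 T2 T3) x) x) =
    pair_form (id_blinfun + T2) (T1 + T3) (x $ 1 + x $ 3) (x $ 2 + x $ 4) +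
    pair_form (id_blinfun - T2) (T1 - T3) (x $ 1 - x $ 3) (x $ 2 - x $ 4)"
proof -
  have sym: "Re (cinner (A u) v) = Re (cinner (A v) u)" if "selfadjoint A" for A :: "'a \<Rightarrow>\<^sub>L 'a" and u v
    by (simp only: selfadjointD[OF that] cinner_Re_commute[of u])
  \<comment> \<open>Orients the cross terms so that both sides become the same linear combination.
    The factor 2 in the claim arises because sums and differences of coordinates are taken without
    normalization.\<close>
  note swap = sym[OF T(1), of "x $ 2" "x $ 1"] sym[OF T(1), of "x $ 4" "x $ 3"]
    sym[OF T(2), of "x $ 3" "x $ 1"] sym[OF T(2), of "x $ 4" "x $ 2"]
    sym[OF T(3), of "x $ 4" "x $ 1"] sym[OF T(3), of "x $ 3" "x $ 2"]
  show ?thesis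
    unfolding cinner_Klein_matrix pair_form_def
    using swap cinner_Re_commute[of "x $ 3" "x $ 1"] cinner_Re_commute[of "x $ 4" "x $ 2"]
    by (simp add: blinfun.add_left blinfun.add_right blinfun.diff_left blinfun.diff_right
        cinner.add_left cinner.add_right cinner.diff_left cinner.diff_right)
qed

lemma positive_Klein_matrix_iff:
  fixes T1 T2 T3 :: "'a::complex_hilbert \<Rightarrow>\<^sub>L 'a"
  assumes T: "selfadjoint T1" "selfadjoint T2" "selfadjoint T3"
  shows "positive_op (block_op (Klein_matrix T1 T2 T3)) \<longleftrightarrow>
    (\<forall>u v. 0 \<le> pair_form (id_blinfun + T2) (T1 + T3) u v) \<and>
    (\<forall>u v. 0 \<le> pair_form (id_blinfun - T2) (T1 - T3) u v)"
    (is "?pos \<longleftrightarrow> ?forms")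
proof -
  let ?M = "Klein_matrix T1 T2 T3"
  have "\<forall>i j. selfadjoint (?M $ i $ j)" "\<forall>i j. ?M $ i $ j = ?M $ j $ i"
    by (simp_all add: forall_4 Klein_matrix_def vector_4 T selfadjoint_id)
  then have "selfadjoint (block_op ?M)" by (intro selfadjoint_block_op) blast+
  then have "?pos \<longleftrightarrow> (\<forall>x. 0 \<le> 2 * Re (cinner (block_op ?M x) x))"
    by (simp add: positive_op_iff)
  also have "\<dots> \<longleftrightarrow> ?forms"
    unfolding Re_cinner_Klein_matrix[OF T]
  proof (intro iffI conjI allI)
    assume nonneg: "\<forall>x::'a ^ 4. 0 \<le> pair_form (id_blinfun + T2) (T1 + T3) (x $ 1 + x $ 3) (x $ 2 + x $ 4) +
      pair_form (id_blinfun - T2) (T1 - T3) (x $ 1 - x $ 3) (x $ 2 - x $ 4)"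
    fix u v :: 'a
    have double: "pair_form A B (u + u) (v + v) = 4 * pair_form A B u v" for A B :: "'a \<Rightarrow>\<^sub>L 'a"
      by (simp add: pair_form_def blinfun.add_right cinner.add_left cinner.add_right)
    have zero: "pair_form A B 0 0 = 0" for A B :: "'a \<Rightarrow>\<^sub>L 'a"
      by (simp add: pair_form_def cinner.zero_left)
    \<comment> \<open>The test vectors make the differences vanish here and the sums vanish below,
      isolating one form at a time; the surviving entries are doubled.\<close>
    show "0 \<le> pair_form (id_blinfun + T2) (T1 + T3) u v"
      using nonneg[rule_format, of "vector [u, v, u, v]"] by (simp add: vector_4 double zero)
    show "0 \<le> pair_form (id_blinfun - T2) (T1 - T3) u v"
      using nonneg[rule_format, of "vector [u, v, - u, - v]"] by (simp add: vector_4 double zero)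
  qed simp
  finally show ?thesis .
qed

section \<open>Positive definite functions on the Klein four-group\<close>

text \<open>Every element is its own inverse, so the symmetry condition is the hypothesis on
  \<open>T\<close>, and the double sum is the quadratic form of the block matrix.\<close>

lemma positive_definite_Klein_iff:
  fixes G :: "('g, 'm) monoid_scheme" and T :: "'g \<Rightarrow> 'a::complex_hilbert \<Rightarrow>\<^sub>L 'a"
  assumes "group G"
    and carrier: "carrier G = {\<one>\<^bsub>G\<^esub>, a, b, a \<otimes>\<^bsub>G\<^esub> b}"
    and card: "card (carrier G) = 4"
    and comm: "a \<otimes>\<^bsub>G\<^esub> b = b \<otimes>\<^bsub>G\<^esub> a"
    and sq: "a \<otimes>\<^bsub>G\<^esub> a = \<one>\<^bsub>G\<^esub>" "b \<otimes>\<^bsub>G\<^esub> b = \<one>\<^bsub>G\<^esub>"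
      "(a \<otimes>\<^bsub>G\<^esub> b) \<otimes>\<^bsub>G\<^esub> (a \<otimes>\<^bsub>G\<^esub> b) = \<one>\<^bsub>G\<^esub>"
    and T_one: "T \<one>\<^bsub>G\<^esub> = id_blinfun"
    and T_adj: "\<forall>s\<in>carrier G. T s = adj_op (T s)"
  shows "positive_definite G T \<longleftrightarrow>
    positive_op (block_op (Klein_matrix (T a) (T b) (T (a \<otimes>\<^bsub>G\<^esub> b))))"
proof -
  interpret group G by (rule assms(1))
  define e c where "e = \<one>\<^bsub>G\<^esub>" and "c = a \<otimes>\<^bsub>G\<^esub> b"
  have carrier': "carrier G = {e, a, b, c}" using carrier by (simp add: e_def c_def)
  have mem: "e \<in> carrier G" "a \<in> carrier G" "b \<in> carrier G" "c \<in> carrier G"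
    by (simp_all add: carrier')
  \<comment> \<open>Listing the carrier does not exclude coincidences; its cardinality does. The
    expansion into sixteen terms depends on this.\<close>
  have "distinct [e, a, b, c]"
    by (rule card_distinct) (use card carrier' in simp)
  then have distinct: "e \<noteq> a" "e \<noteq> b" "e \<noteq> c" "a \<noteq> b" "a \<noteq> c" "b \<noteq> c"
    "a \<noteq> e" "b \<noteq> e" "c \<noteq> e" "b \<noteq> a" "c \<noteq> a" "c \<noteq> b"
    by auto
  have inv: "inv\<^bsub>G\<^esub> e = e" "inv\<^bsub>G\<^esub> a = a" "inv\<^bsub>G\<^esub> b = b" "inv\<^bsub>G\<^esub> c = c"
    using mem sq by (auto intro!: inv_equality simp: e_def c_def)
  have c_eq: "c = b \<otimes>\<^bsub>G\<^esub> a" by (simp only: c_def comm)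
  have "a \<otimes>\<^bsub>G\<^esub> c = b"
    unfolding c_def using mem by (simp add: sq flip: m_assoc)
  moreover have "b \<otimes>\<^bsub>G\<^esub> c = a"
    unfolding c_eq using mem by (simp add: sq flip: m_assoc)
  moreover have "c \<otimes>\<^bsub>G\<^esub> b = a"
    unfolding c_def using mem by (simp add: sq m_assoc)
  moreover have "c \<otimes>\<^bsub>G\<^esub> a = b"
    unfolding c_eq using mem by (simp add: sq m_assoc)
  ultimately have mult: "a \<otimes>\<^bsub>G\<^esub> c = b" "c \<otimes>\<^bsub>G\<^esub> b = a" "b \<otimes>\<^bsub>G\<^esub> a = c" "a \<otimes>\<^bsub>G\<^esub> b = c"
    "b \<otimes>\<^bsub>G\<^esub> c = a" "c \<otimes>\<^bsub>G\<^esub> a = b" "a \<otimes>\<^bsub>G\<^esub> a = e" "b \<otimes>\<^bsub>G\<^esub> b = e" "c \<otimes>\<^bsub>G\<^esub> c = e"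
    "\<And>s. s \<in> carrier G \<Longrightarrow> e \<otimes>\<^bsub>G\<^esub> s = s" "\<And>s. s \<in> carrier G \<Longrightarrow> s \<otimes>\<^bsub>G\<^esub> e = s"
    using sq by (simp_all add: e_def c_def comm[symmetric])
  have T_e: "T e = id_blinfun" using T_one by (simp add: e_def)
  let ?M = "Klein_matrix (T a) (T b) (T c)"
  have fin: "finite (carrier G)" by (simp add: carrier')
  have sum: "(\<Sum>s\<in>{s \<in> carrier G. h s \<noteq> 0}. \<Sum>t\<in>{t \<in> carrier G. h t \<noteq> 0}.
      cinner (T (inv\<^bsub>G\<^esub> t \<otimes>\<^bsub>G\<^esub> s) (h s)) (h t)) = cinner (block_op ?M x) x"
    if x: "x $ 1 = h e" "x $ 2 = h a" "x $ 3 = h b" "x $ 4 = h c" for h and x :: "'a ^ 4"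
  proof -
    have "(\<Sum>s\<in>{s \<in> carrier G. h s \<noteq> 0}. \<Sum>t\<in>{t \<in> carrier G. h t \<noteq> 0}.
        cinner (T (inv\<^bsub>G\<^esub> t \<otimes>\<^bsub>G\<^esub> s) (h s)) (h t)) =
      (\<Sum>s\<in>{s \<in> carrier G. h s \<noteq> 0}. \<Sum>t\<in>carrier G. cinner (T (inv\<^bsub>G\<^esub> t \<otimes>\<^bsub>G\<^esub> s) (h s)) (h t))"
      by (intro sum.cong refl sum.mono_neutral_left fin) (auto simp: cinner.zero_right)
    also have "\<dots> = (\<Sum>s\<in>carrier G. \<Sum>t\<in>carrier G. cinner (T (inv\<^bsub>G\<^esub> t \<otimes>\<^bsub>G\<^esub> s) (h s)) (h t))"
      by (intro sum.mono_neutral_left fin) (auto simp: cinner.zero_left)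
    also have "\<dots> = cinner (block_op ?M x) x"
      unfolding cinner_Klein_matrix x
      using mem by (simp add: carrier' distinct inv mult T_e)
    finally show ?thesis .
  qed
  show ?thesis
    unfolding c_def[symmetric]
  proof
    assume pd: "positive_definite G T"
    show "positive_op (block_op ?M)"
      unfolding positive_op_def
    proof
      fix x :: "'a ^ 4"
      \<comment> \<open>The last branch serves \<open>c\<close>; its values outside the carrier do
        not enter the sums.\<close>
      define h where
        "h s = (if s = e then x $ 1 else if s = a then x $ 2 else if s = b then x $ 3 else x $ 4)" for s
      have "(\<Sum>s\<in>{s \<in> carrier G. h s \<noteq> 0}. \<Sum>t\<in>{t \<in> carrier G. h t \<noteq> 0}.
          cinner (T (inv\<^bsub>G\<^esub> t \<otimes>\<^bsub>G\<^esub> s) (h s)) (h t)) \<in> \<real>\<^sub>\<ge>\<^sub>0"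
        using pd fin by (simp add: positive_definite_def)
      moreover have "x $ 1 = h e" "x $ 2 = h a" "x $ 3 = h b" "x $ 4 = h c"
        by (simp_all add: h_def distinct)
      ultimately show "cinner (block_op ?M x) x \<in> \<real>\<^sub>\<ge>\<^sub>0"
        using sum by simp
    qed
  next
    assume pos: "positive_op (block_op ?M)"
    show "positive_definite G T"
      unfolding positive_definite_def
    proof (intro conjI ballI allI impI)
      fix s assume s: "s \<in> carrier G"
      then have "inv\<^bsub>G\<^esub> s = s" using inv carrier' by auto
      then show "T (inv\<^bsub>G\<^esub> s) = adj_op (T s)" using T_adj s by simp
    next
      fix h :: "'g \<Rightarrow> 'a"
      have "(\<Sum>s\<in>{s \<in> carrier G. h s \<noteq> 0}. \<Sum>t\<in>{t \<in> carrier G. h t \<noteq> 0}.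
          cinner (T (inv\<^bsub>G\<^esub> t \<otimes>\<^bsub>G\<^esub> s) (h s)) (h t)) =
        cinner (block_op ?M (vector [h e, h a, h b, h c])) (vector [h e, h a, h b, h c])"
        by (rule sum) (simp_all add: vector_4)
      then show "(\<Sum>s\<in>{s \<in> carrier G. h s \<noteq> 0}. \<Sum>t\<in>{t \<in> carrier G. h t \<noteq> 0}.
          cinner (T (inv\<^bsub>G\<^esub> t \<otimes>\<^bsub>G\<^esub> s) (h s)) (h t)) \<in> \<real>\<^sub>\<ge>\<^sub>0"
        using pos by (simp add: positive_op_def)
    qed
  qed
qed

theorem theorem3p18:
  fixes G :: "('g, 'm) monoid_scheme" and a b :: 'g
    and T :: "'g \<Rightarrow> 'a::complex_hilbert \<Rightarrow>\<^sub>L 'a"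
    and T1 T2 T3 :: "'a \<Rightarrow>\<^sub>L 'a"
  assumes "group G"
    and "G \<cong> integer_mod_group 2 \<times>\<times> integer_mod_group 2"
    and "carrier G = {\<one>\<^bsub>G\<^esub>, a, b, a \<otimes>\<^bsub>G\<^esub> b}"
    and "a \<otimes>\<^bsub>G\<^esub> b = b \<otimes>\<^bsub>G\<^esub> a"
    and "a \<otimes>\<^bsub>G\<^esub> a = \<one>\<^bsub>G\<^esub>" and "b \<otimes>\<^bsub>G\<^esub> b = \<one>\<^bsub>G\<^esub>"
    and "(a \<otimes>\<^bsub>G\<^esub> b) \<otimes>\<^bsub>G\<^esub> (a \<otimes>\<^bsub>G\<^esub> b) = \<one>\<^bsub>G\<^esub>"
    and "\<forall>s\<in>carrier G. T s \<in> bounded_ops"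
    and "T \<one>\<^bsub>G\<^esub> = id_blinfun"
    and "\<forall>s\<in>carrier G. T s = adj_op (T s)"
    and "T a = T1" and "T b = T2" and "T (a \<otimes>\<^bsub>G\<^esub> b) = T3"
  defines "\<Delta> \<equiv> (vector
      [vector [id_blinfun, T1, T2, T3],
       vector [T1, id_blinfun, T3, T2],
       vector [T2, T3, id_blinfun, T1],
       vector [T3, T2, T1, id_blinfun]] :: ('a \<Rightarrow>\<^sub>L 'a) ^ 4 ^ 4)"
    and "K_plus \<equiv> closure (range (blinfun_apply (id_blinfun + T2)))"
    and "K_minus \<equiv> closure (range (blinfun_apply (id_blinfun - T2)))"
  shows "(positive_definite G T \<longleftrightarrow> positive_op (block_op \<Delta>)) \<and>
    (positive_op (block_op \<Delta>) \<longleftrightarrow>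
      contraction T1 \<and> le_op T2 id_blinfun \<and> le_op (- T2) id_blinfun \<and>
      (\<exists>\<Gamma>_plus \<Gamma>_minus.
        contraction_on K_plus \<Gamma>_plus \<and> contraction_on K_minus \<Gamma>_minus \<and>
        (\<forall>x. (T1 + T3) x = sqrt_op (id_blinfun + T2) (\<Gamma>_plus (sqrt_op (id_blinfun + T2) x))) \<and>
        (\<forall>x. (T1 - T3) x = sqrt_op (id_blinfun - T2) (\<Gamma>_minus (sqrt_op (id_blinfun - T2) x)))))"
proof -
  have sa: "selfadjoint T1" "selfadjoint T2" "selfadjoint T3"
    using assms(3,8,10-13) by (auto intro!: selfadjoint_if_adj_op)
  have \<Delta>: "\<Delta> = Klein_matrix T1 T2 T3"
    by (simp add: \<Delta>_def Klein_matrix_def)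
  \<comment> \<open>The isomorphism rules out a collapsed group in which the relations still
    hold.\<close>
  have "card (carrier G) = 4"
    using iso_same_card[OF assms(2)] by (simp add: carrier_integer_mod_group)
  from positive_definite_Klein_iff[OF assms(1,3) this assms(4-7,9,10)]
  have pd: "positive_definite G T \<longleftrightarrow> positive_op (block_op \<Delta>)"
    by (simp add: \<Delta> assms(11-13))
  note forms = positive_Klein_matrix_iff[OF sa, folded \<Delta>]
  have T2_iff: "le_op T2 id_blinfun \<and> le_op (- T2) id_blinfun \<longleftrightarrow>
    (\<forall>x. 0 \<le> Re (cinner ((id_blinfun + T2) x) x)) \<and> (\<forall>x. 0 \<le> Re (cinner ((id_blinfun - T2) x) x))"
    using sa by (auto simp: le_op_def positive_op_iff selfadjoint_add selfadjoint_diff selfadjoint_id)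
  \<comment> \<open>Conditional on the bounds for \<open>T2\<close>, which secure the square roots;
    \<open>necessary\<close> recovers them from positivity.\<close>
  have factor: "(\<exists>\<Gamma>_plus \<Gamma>_minus.
        contraction_on K_plus \<Gamma>_plus \<and> contraction_on K_minus \<Gamma>_minus \<and>
        (\<forall>x. (T1 + T3) x = sqrt_op (id_blinfun + T2) (\<Gamma>_plus (sqrt_op (id_blinfun + T2) x))) \<and>
        (\<forall>x. (T1 - T3) x = sqrt_op (id_blinfun - T2) (\<Gamma>_minus (sqrt_op (id_blinfun - T2) x)))) \<longleftrightarrow>
      positive_op (block_op \<Delta>)"
    if "le_op T2 id_blinfun" "le_op (- T2) id_blinfun"
  proof -
    have norm: "norm T2 \<le> 1" by (rule selfadjoint_norm_le_one[OF sa(2) that])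
    then have "norm (- T2) \<le> 1" by simp
    note plus = contraction_factor_iff[OF selfadjoint_minus[OF sa(2)] this selfadjoint_add[OF sa(1,3)],
        unfolded diff_minus_eq_add, folded K_plus_def pair_form_def]
    note minus = contraction_factor_iff[OF sa(2) norm selfadjoint_diff[OF sa(1,3)],
        folded K_minus_def pair_form_def]
    show ?thesis
      unfolding forms plus[symmetric] minus[symmetric] by blast
  qed
  have necessary: "contraction T1 \<and> le_op T2 id_blinfun \<and> le_op (- T2) id_blinfun"
    if "positive_op (block_op \<Delta>)"
  proof -
    have nonneg: "0 \<le> pair_form (id_blinfun + T2) (T1 + T3) u v"
      "0 \<le> pair_form (id_blinfun - T2) (T1 - T3) u v" for u v
      using that unfolding forms by blast+
    \<comment> \<open>Adding the two forms cancels \<open>T2\<close> and \<open>T3\<close>. The pair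
      \<open>(u, u)\<close> leaves four times the form of \<open>I + T1\<close>, the pair
      \<open>(u, - u)\<close> that of \<open>I - T1\<close>.\<close>
    have "0 \<le> Re (cinner ((id_blinfun + T1) u) u)" "0 \<le> Re (cinner ((id_blinfun - T1) u) u)" for u
      using nonneg[of u u] nonneg[of u "- u"]
      by (simp_all add: pair_form_def blinfun.add_left blinfun.diff_left blinfun.minus_right
          cinner.add_left cinner.diff_left cinner.minus_left cinner.minus_right)
    then have "le_op T1 id_blinfun" "le_op (- T1) id_blinfun"
      using sa by (auto simp: le_op_def positive_op_iff selfadjoint_add selfadjoint_diff selfadjoint_id)
    then have "contraction T1"
      using sa(1) by (simp add: contraction_def selfadjoint_bounded_ops selfadjoint_norm_le_one)
    moreover have "0 \<le> Re (cinner ((id_blinfun + T2) u) u)" "0 \<le> Re (cinner ((id_blinfun - T2) u) u)" for u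
      using nonneg[of u 0] by (simp_all add: pair_form_def cinner.zero_right)
    ultimately show ?thesis using T2_iff by blast
  qed
  show ?thesis
    using pd factor necessary by blast
qed

end
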